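(* Let $\mathcal{P}:=(P^i)_{i=1}^n$ be a finite family of rational polyhedra in $\mathbb{R}^d$ such that $\operatorname{ext}(P^i)\neq\emptyset$ for all $i\in\{1,\dots,n\}$ and $P^i_\infty=P^j_\infty$ for all $i,j\in\{1,\dots,n\}$. Let $k\geq\lceil\log_2 n\rceil$ and let $H=(h^i)_{i=1}^n$ be a family of pairwise distinct vectors in $\{0,1\}^k$. Then an ideal formulation of $x\in\bigcup_{i=1}^n P^i$ is given by $$(x,y)\in Q(\mathcal{P},H),\qquad y\in\mathbb{Z}^k.$$ Furthermore, besides the integrality constraints on $y$, this formulation only includes linear inequalities with rational coefficients (that is, $Q(\mathcal{P},H)$ is described by finitely many linear inequalities with rational coefficients).
   Context: For a polyhedron $P$, $\operatorname{ext}(P)$ denotes its set of extreme points and $P_\infty$ its recession cone. A rational polyhedron is one described by finitely many linear inequalities with rational coefficients. Define $Q(\mathcal{P},H):=\operatorname{conv}\left(\bigcup_{i=1}^n P^i\times\{h^i\}\right)\subseteq\mathbb{R}^{d}\times\mathbb{R}^k$. A system "$(x,y)\in Q$, $y\in\mathbb{Z}^k$" with $Q\subseteq \mathbb{R}^{d}\times\mathbb{R}^k$ a rational polyhedron is a (mixed integer programming) formulation of $x\in S\subseteq\mathbb{R}^d$ if $S$ is the projection onto the $x$ variables of $Q\cap(\mathbb{R}^d\times\mathbb{Z}^k)$. The polyhedron $Q$ is the LP relaxation of the formulation, which is assumed to have at least one extreme point. The formulation is ideal if all extreme points $(x,y)$ of $Q$ satisfy $y\in\mathbb{Z}^k$.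 *)

theory Defs
  imports "HOL-Analysis.Analysis"
begin

(* On real ^ 'd \<times> real ^ 'k the elements of Basis are the coordinate vectors of the two factors,
   so the condition below says that all coefficients of the inequalities are rational.
   The coefficient vector 0 is allowed, in particular the empty set is a rational polyhedron. *)
definition rational_polyhedron :: "'a::euclidean_space set \<Rightarrow> bool" where
  "rational_polyhedron S \<longleftrightarrow>
     (\<exists>I :: ('a \<times> real) set. finite I
        \<and> (\<forall>(a, b) \<in> I. (\<forall>e \<in> Basis. a \<bullet> e \<in> \<rat>) \<and> b \<in> \<rat>)
        \<and> S = {x. \<forall>(a, b) \<in> I. a \<bullet> x \<le> b})"

definition ext :: "'a::real_vector set \<Rightarrow> 'a set" where
  "ext S = {x. x extreme_point_of S}"

definition recession_cone :: "'a::real_vector set \<Rightarrow> 'a set" where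
  "recession_cone S = {r. \<forall>x \<in> S. \<forall>t \<ge> 0. x + t *\<^sub>R r \<in> S}"

definition int_vectors :: "(real ^ 'k) set" where
  "int_vectors = {y. \<forall>j. y $ j \<in> \<int>}"

definition mip_formulation :: "((real ^ 'd) \<times> (real ^ 'k)) set \<Rightarrow> (real ^ 'd) set \<Rightarrow> bool" where
  "mip_formulation Q S \<longleftrightarrow>
     rational_polyhedron Q \<and> ext Q \<noteq> {} \<and> S = fst ` (Q \<inter> (UNIV \<times> int_vectors))"

definition ideal_formulation :: "((real ^ 'd) \<times> (real ^ 'k)) set \<Rightarrow> (real ^ 'd) set \<Rightarrow> bool" where
  "ideal_formulation Q S \<longleftrightarrow>
     mip_formulation Q S \<and> (\<forall>(x, y) \<in> ext Q. y \<in> int_vectors)"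

(* The families are indexed by 1, ..., n; their values at other indices are irrelevant. *)
definition embedding_hull ::
  "nat \<Rightarrow> (nat \<Rightarrow> (real ^ 'd) set) \<Rightarrow> (nat \<Rightarrow> real ^ 'k) \<Rightarrow> ((real ^ 'd) \<times> (real ^ 'k)) set" where
  "embedding_hull n P h = convex hull (\<Union>i\<in>{1..n}. P i \<times> {h i})"

end

theory Submission
  imports Defs
begin

text \<open>
  Write \<open>Q\<close> for the convex hull of the sets \<open>P i \<times> {h i}\<close>. The proof combines two independent
  facts, one about polyhedra with a common recession cone and one about the vertices of the cube.

  That \<open>Q\<close> is a rational polyhedron depends on the \<open>P i\<close> having the same recession cone \<open>R\<close>. In
  general the convex hull of a union of polyhedra need not be closed: its closure contains \<open>x + r\<close>
  for \<open>x\<close> in one of them and \<open>r\<close> a recession direction of another. With a common \<open>R\<close> such points are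
  in the hull already. Concretely, lift each \<open>K = P i \<times> {h i}\<close> to the polyhedral cone over
  \<open>K \<times> {1}\<close>. The hull is the slice at height 1 of the sum of these cones: in a point
  of that slice, the terms at height 0 add up to an element of \<open>R\<close>, which can be added to each of
  the terms of positive height (\<open>convex_hull_Union_eq_homogenization_slice\<close>). Sums of rational
  polyhedra are projections of rational polyhedra, and Fourier--Motzkin elimination shows that these
  are again rational polyhedra (\<open>rational_polyhedron_fst_image\<close>).

  That the formulation is valid and ideal uses that each binary vector \<open>v\<close> is the unique maximizer
  over the cube of a linear functional. This functional exposes the slice of \<open>Q\<close> at \<open>y = v\<close> as a
  face that is spanned by those \<open>P i \<times> {h i}\<close> with \<open>h i = v\<close> (\<open>embedding_hull_binary_slice\<close>). As
  the \<open>h i\<close> are distinct, there is at most one such \<open>i\<close>. So a point of \<open>Q\<close> with integral, hence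
  binary, \<open>y\<close> has its \<open>x\<close> in some \<open>P i\<close>, and an extreme point of \<open>P 1\<close> gives one of \<open>Q\<close>. The extreme
  points of \<open>Q\<close> have integral \<open>y\<close> because an extreme point of a convex hull lies in the spanning set.
\<close>

section \<open>Rational polyhedra and affine preimages\<close>

definition rational_vector :: "'a::euclidean_space \<Rightarrow> bool" where
  "rational_vector a \<longleftrightarrow> (\<forall>e\<in>Basis. a \<bullet> e \<in> \<rat>)"

lemma rational_vector_inner: "rational_vector a \<Longrightarrow> rational_vector b \<Longrightarrow> a \<bullet> b \<in> \<rat>"
  by (subst euclidean_inner) (auto simp: rational_vector_def intro!: Rats_sum Rats_mult)

lemma rational_vector_Basis: "e \<in> Basis \<Longrightarrow> rational_vector e"
  by (auto simp: rational_vector_def inner_Basis)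

lemma rational_vector_zero [simp]: "rational_vector 0"
  by (simp add: rational_vector_def)

lemma rational_vector_uminus: "rational_vector a \<Longrightarrow> rational_vector (- a)"
  by (simp add: rational_vector_def)

lemma rational_vector_diff: "rational_vector a \<Longrightarrow> rational_vector b \<Longrightarrow> rational_vector (a - b)"
  by (simp add: rational_vector_def inner_diff_left)

lemma rational_vector_scaleR: "c \<in> \<rat> \<Longrightarrow> rational_vector a \<Longrightarrow> rational_vector (c *\<^sub>R a)"
  by (simp add: rational_vector_def)

lemma rational_vector_Pair: "rational_vector (a, b) \<longleftrightarrow> rational_vector a \<and> rational_vector b"
  by (simp add: rational_vector_def Basis_prod_def ball_Un)

lemma rational_vector_real: "rational_vector (c :: real) \<longleftrightarrow> c \<in> \<rat>"
  by (simp add: rational_vector_def)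

lemma rational_polyhedron_iff:
  "rational_polyhedron S \<longleftrightarrow>
     (\<exists>I. finite I \<and> (\<forall>p\<in>I. rational_vector (fst p) \<and> snd p \<in> \<rat>)
        \<and> S = {x. \<forall>p\<in>I. fst p \<bullet> x \<le> snd p})"
  by (simp add: rational_polyhedron_def rational_vector_def case_prod_beta)

lemma rational_polyhedronE:
  assumes "rational_polyhedron S"
  obtains I where "finite I" and "\<And>p. p \<in> I \<Longrightarrow> rational_vector (fst p)"
    and "\<And>p. p \<in> I \<Longrightarrow> snd p \<in> \<rat>" and "S = {x. \<forall>p\<in>I. fst p \<bullet> x \<le> snd p}"
  using assms unfolding rational_polyhedron_iff by blast

lemma rational_polyhedronI:
  assumes "finite I" and "\<And>p. p \<in> I \<Longrightarrow> rational_vector (fst p)"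
    and "\<And>p. p \<in> I \<Longrightarrow> snd p \<in> \<rat>" and "S = {x. \<forall>p\<in>I. fst p \<bullet> x \<le> snd p}"
  shows "rational_polyhedron S"
  using assms unfolding rational_polyhedron_iff by blast

lemma rational_polyhedron_convex: "rational_polyhedron S \<Longrightarrow> convex S"
proof (erule rational_polyhedronE)
  fix I assume "S = {x. \<forall>p\<in>I. fst p \<bullet> x \<le> snd p}"
  then have "S = (\<Inter>p\<in>I. {x. fst p \<bullet> x \<le> snd p})"
    by auto
  then show "convex S"
    by (simp add: convex_INT convex_halfspace_le)
qed

lemma rational_polyhedron_Int:
  assumes "rational_polyhedron S" and "rational_polyhedron T"
  shows "rational_polyhedron (S \<inter> T)"
proof -
  obtain I where I: "finite I" "\<And>p. p \<in> I \<Longrightarrow> rational_vector (fst p)"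
    "\<And>p. p \<in> I \<Longrightarrow> snd p \<in> \<rat>" "S = {x. \<forall>p\<in>I. fst p \<bullet> x \<le> snd p}"
    using assms(1) by (rule rational_polyhedronE) blast
  obtain J where J: "finite J" "\<And>p. p \<in> J \<Longrightarrow> rational_vector (fst p)"
    "\<And>p. p \<in> J \<Longrightarrow> snd p \<in> \<rat>" "T = {x. \<forall>p\<in>J. fst p \<bullet> x \<le> snd p}"
    using assms(2) by (rule rational_polyhedronE) blast
  show ?thesis
    by (rule rational_polyhedronI[of "I \<union> J"]) (use I J in auto)
qed

lemma rational_polyhedron_singleton:
  assumes "rational_vector c"
  shows "rational_polyhedron {c}"
proof (rule rational_polyhedronI[of "(\<lambda>e. (e, e \<bullet> c)) ` Basis \<union> (\<lambda>e. (- e, - (e \<bullet> c))) ` Basis"])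
  have "x = c" if "\<forall>e\<in>Basis. e \<bullet> x \<le> e \<bullet> c" "\<forall>e\<in>Basis. e \<bullet> c \<le> e \<bullet> x" for x
    by (rule euclidean_eqI) (metis that antisym inner_commute)
  then show "{c} = {x. \<forall>p\<in>(\<lambda>e. (e, e \<bullet> c)) ` Basis \<union> (\<lambda>e. (- e, - (e \<bullet> c))) ` Basis. fst p \<bullet> x \<le> snd p}"
    by (auto simp: ball_Un)
qed (use assms in \<open>auto simp: rational_vector_Basis rational_vector_uminus rational_vector_inner\<close>)

text \<open>
  The inequalities pull back along the adjoint of the linear part, whose matrix is the transpose of
  a rational matrix.
\<close>

lemma rational_polyhedron_affine_preimage:
  fixes f :: "'a::euclidean_space \<Rightarrow> 'b::euclidean_space"
  assumes f: "linear f" "\<And>e. e \<in> Basis \<Longrightarrow> rational_vector (f e)"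
    and c: "rational_vector c" and S: "rational_polyhedron S"
  shows "rational_polyhedron {x. f x + c \<in> S}"
proof -
  obtain I where I: "finite I" "\<And>p. p \<in> I \<Longrightarrow> rational_vector (fst p)"
    "\<And>p. p \<in> I \<Longrightarrow> snd p \<in> \<rat>" "S = {x. \<forall>p\<in>I. fst p \<bullet> x \<le> snd p}"
    using S by (rule rational_polyhedronE) blast
  have adj: "adjoint f a \<bullet> x = a \<bullet> f x" for a x
    using adjoint_works[OF f(1), of x a] by (simp add: inner_commute)
  have adj_rat: "rational_vector (adjoint f a)" if "rational_vector a" for a
    unfolding rational_vector_def adj using that f(2) by (blast intro: rational_vector_inner)
  show ?thesis
  proof (rule rational_polyhedronI[of "(\<lambda>p. (adjoint f (fst p), snd p - fst p \<bullet> c)) ` I"])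
    show "{x. f x + c \<in> S}
        = {x. \<forall>p\<in>(\<lambda>p. (adjoint f (fst p), snd p - fst p \<bullet> c)) ` I. fst p \<bullet> x \<le> snd p}"
      by (simp add: I(4) adj inner_add_right le_diff_eq)
  qed ((elim imageE)?; simp add: I(2,3) adj_rat c rational_vector_inner I(1))+
qed

lemma rational_polyhedron_linear_preimage:
  fixes f :: "'a::euclidean_space \<Rightarrow> 'b::euclidean_space"
  assumes "linear f" and "\<And>e. e \<in> Basis \<Longrightarrow> rational_vector (f e)" and "rational_polyhedron S"
  shows "rational_polyhedron (f -` S)"
  using rational_polyhedron_affine_preimage[OF assms(1,2) rational_vector_zero assms(3)]
  by (simp add: vimage_def)

lemma rational_polyhedron_fst_vimage:
  fixes S :: "'a::euclidean_space set"
  assumes "rational_polyhedron S"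
  shows "rational_polyhedron (fst -` S :: ('a \<times> 'b::euclidean_space) set)"
  using assms
  by (intro rational_polyhedron_linear_preimage linear_fst)
     (auto simp: Basis_prod_def intro: rational_vector_Basis)

lemma rational_polyhedron_snd_vimage:
  fixes S :: "'b::euclidean_space set"
  assumes "rational_polyhedron S"
  shows "rational_polyhedron (snd -` S :: ('a::euclidean_space \<times> 'b) set)"
  using assms
  by (intro rational_polyhedron_linear_preimage linear_snd)
     (auto simp: Basis_prod_def intro: rational_vector_Basis)

lemma rational_polyhedron_Times:
  assumes "rational_polyhedron S" and "rational_polyhedron T"
  shows "rational_polyhedron (S \<times> T)"
proof -
  have "S \<times> T = fst -` S \<inter> snd -` T"
    by auto
  then show ?thesis
    using assms
    by (simp add: rational_polyhedron_Int rational_polyhedron_fst_vimage rational_polyhedron_snd_vimage)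
qed

section \<open>Fourier--Motzkin elimination\<close>

lemma finite_lower_upper_bounds_separated:
  fixes L U :: "'a::{linorder, no_bot, no_top} set"
  assumes "finite L" and "finite U" and "\<And>l u. l \<in> L \<Longrightarrow> u \<in> U \<Longrightarrow> l \<le> u"
  obtains t where "\<And>l. l \<in> L \<Longrightarrow> l \<le> t" and "\<And>u. u \<in> U \<Longrightarrow> t \<le> u"
proof (cases "L = {}")
  case True
  show ?thesis
    by (rule that[of "if U = {} then undefined else Min U"]) (use True assms(2) in auto)
next
  case False
  show ?thesis
    by (rule that[of "Max L"]) (use False assms in auto)
qed

text \<open>
  One step of Fourier--Motzkin elimination. Along the line \<open>x + t e\<close>, an inequality is independent of
  \<open>t\<close> or bounds \<open>t\<close> from above or from below, according to the sign of its slope in direction \<open>e\<close>. A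
  suitable \<open>t\<close> exists iff each lower bound is at most each upper bound, and multiplying this
  condition by both slopes gives a linear inequality in \<open>x\<close> with rational coefficients.
\<close>

lemma rational_polyhedron_eliminate_direction:
  assumes e: "rational_vector e" and S: "rational_polyhedron S"
  shows "rational_polyhedron {x. \<exists>t. x + t *\<^sub>R e \<in> S}"
proof -
  obtain I where I: "finite I" "\<And>p. p \<in> I \<Longrightarrow> rational_vector (fst p)"
    "\<And>p. p \<in> I \<Longrightarrow> snd p \<in> \<rat>" "S = {x. \<forall>p\<in>I. fst p \<bullet> x \<le> snd p}"
    using S by (rule rational_polyhedronE) blast
  define slope where "slope p = fst p \<bullet> e" for p :: "'a \<times> real"
  define Z where "Z = {p\<in>I. slope p = 0}"
  define U where "U = {p\<in>I. slope p > 0}"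
  define L where "L = {p\<in>I. slope p < 0}"
  define comb where "comb = (\<lambda>(p, q). slope p *\<^sub>R q - slope q *\<^sub>R p)"
  have slope_rat: "slope p \<in> \<rat>" if "p \<in> I" for p
    using that I(2) e by (simp add: slope_def rational_vector_inner)
  have S_iff: "x + t *\<^sub>R e \<in> S \<longleftrightarrow> (\<forall>p\<in>I. fst p \<bullet> x + t * slope p \<le> snd p)" for x t
    by (simp add: I(4) inner_add_right slope_def)
  have comb_iff: "fst (comb (p, q)) \<bullet> x \<le> snd (comb (p, q)) \<longleftrightarrow>
      slope p * (fst q \<bullet> x) - slope q * (fst p \<bullet> x) \<le> slope p * snd q - slope q * snd p" for p q x
    by (simp add: comb_def inner_diff_left)
  show ?thesis
  proof (rule rational_polyhedronI[of "Z \<union> comb ` (U \<times> L)"])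
    show "finite (Z \<union> comb ` (U \<times> L))"
      using I(1) by (simp add: Z_def U_def L_def)
    have comb_rat: "rational_vector (fst (comb (p, q))) \<and> snd (comb (p, q)) \<in> \<rat>"
      if "p \<in> I" "q \<in> I" for p q
      using that by (simp add: comb_def I(2,3) slope_rat rational_vector_diff rational_vector_scaleR)
    show "rational_vector (fst p)" "snd p \<in> \<rat>" if "p \<in> Z \<union> comb ` (U \<times> L)" for p
      using that by (elim UnE imageE SigmaE; simp add: Z_def U_def L_def I(2,3) comb_rat)+
    show "{x. \<exists>t. x + t *\<^sub>R e \<in> S} = {x. \<forall>p\<in>Z \<union> comb ` (U \<times> L). fst p \<bullet> x \<le> snd p}"
    proof (intro set_eqI iffI)
      fix x assume "x \<in> {x. \<exists>t. x + t *\<^sub>R e \<in> S}"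
      then obtain t where t: "fst p \<bullet> x + t * slope p \<le> snd p" if "p \<in> I" for p
        by (auto simp: S_iff)
      have "fst (comb (p, q)) \<bullet> x \<le> snd (comb (p, q))" if "p \<in> U" "q \<in> L" for p q
      proof -
        have "slope p * (fst q \<bullet> x + t * slope q) \<le> slope p * snd q"
          using that t[of q] by (intro mult_left_mono) (auto simp: U_def L_def)
        moreover have "slope q * snd p \<le> slope q * (fst p \<bullet> x + t * slope p)"
          using that t[of p] by (intro mult_left_mono_neg) (auto simp: U_def L_def)
        ultimately show ?thesis
          unfolding comb_iff by (simp add: algebra_simps)
      qed
      moreover have "fst p \<bullet> x \<le> snd p" if "p \<in> Z" for p
        using that t[of p] by (simp add: Z_def)
      ultimately show "x \<in> {x. \<forall>p\<in>Z \<union> comb ` (U \<times> L). fst p \<bullet> x \<le> snd p}"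
        by blast
    next
      fix x assume x: "x \<in> {x. \<forall>p\<in>Z \<union> comb ` (U \<times> L). fst p \<bullet> x \<le> snd p}"
      define bound where "bound p = (snd p - fst p \<bullet> x) / slope p" for p
      have le: "bound q \<le> bound p" if "q \<in> L" "p \<in> U" for p q
      proof -
        have "fst (comb (p, q)) \<bullet> x \<le> snd (comb (p, q))"
          using x that by blast
        moreover have "slope p > 0" "slope q < 0"
          using that by (simp_all add: U_def L_def)
        ultimately show ?thesis
          by (simp add: bound_def comb_iff field_simps)
      qed
      obtain t where lower: "\<And>l. l \<in> bound ` L \<Longrightarrow> l \<le> t" and upper: "\<And>u. u \<in> bound ` U \<Longrightarrow> t \<le> u"
        by (rule finite_lower_upper_bounds_separated[of "bound ` L" "bound ` U"])
           (use I(1) le in \<open>auto simp: L_def U_def\<close>)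
      have "fst p \<bullet> x + t * slope p \<le> snd p" if p: "p \<in> I" for p
      proof (cases "slope p" "0::real" rule: linorder_cases)
        case less
        then have "bound p \<le> t"
          using p by (intro lower imageI) (simp add: L_def)
        then show ?thesis
          using less by (simp add: bound_def field_simps)
      next
        case equal
        then have "p \<in> Z"
          using p by (simp add: Z_def)
        then show ?thesis
          using x equal by simp
      next
        case greater
        then have "t \<le> bound p"
          using p by (intro upper imageI) (simp add: U_def)
        then show ?thesis
          using greater by (simp add: bound_def field_simps)
      qed
      then show "x \<in> {x. \<exists>t. x + t *\<^sub>R e \<in> S}"
        unfolding S_iff by blast
    qed
  qed
qed

text \<open>
  Adding a whole subspace, rather than projecting it away, keeps the type of the ambient space fixed,
  so that directions can be eliminated one at a time by induction.
\<close>

lemma rational_polyhedron_eliminate_span: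
  assumes "finite B" and "\<And>e. e \<in> B \<Longrightarrow> rational_vector e" and "rational_polyhedron S"
  shows "rational_polyhedron {x. \<exists>v\<in>span B. x + v \<in> S}"
  using assms(1,2)
proof (induction B rule: finite_induct)
  case empty
  then show ?case
    using assms(3) by simp
next
  case (insert e B)
  have "{x. \<exists>v\<in>span (insert e B). x + v \<in> S} = {x. \<exists>t. x + t *\<^sub>R e \<in> {x. \<exists>v\<in>span B. x + v \<in> S}}"
  proof (intro set_eqI iffI)
    fix x assume "x \<in> {x. \<exists>v\<in>span (insert e B). x + v \<in> S}"
    then obtain v t where "x + v \<in> S" "v - t *\<^sub>R e \<in> span B"
      by (auto simp: span_insert)
    then show "x \<in> {x. \<exists>t. x + t *\<^sub>R e \<in> {x. \<exists>v\<in>span B. x + v \<in> S}}"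
      by (auto intro!: exI[of _ t] bexI[of _ "v - t *\<^sub>R e"])
  next
    fix x assume "x \<in> {x. \<exists>t. x + t *\<^sub>R e \<in> {x. \<exists>v\<in>span B. x + v \<in> S}}"
    then obtain t v where "v \<in> span B" "x + t *\<^sub>R e + v \<in> S"
      by auto
    then show "x \<in> {x. \<exists>v\<in>span (insert e B). x + v \<in> S}"
      by (auto simp: span_insert add.assoc intro!: exI[of _ "t *\<^sub>R e + v"] exI[of _ t])
  qed
  moreover have "rational_polyhedron \<dots>"
    using insert by (intro rational_polyhedron_eliminate_direction) auto
  ultimately show ?case
    by simp
qed

lemma rational_polyhedron_fst_image:
  fixes S :: "('a::euclidean_space \<times> 'b::euclidean_space) set"
  assumes "rational_polyhedron S"
  shows "rational_polyhedron (fst ` S)"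
proof -
  let ?B = "Pair (0::'a) ` (Basis :: 'b set)"
  have "span ?B = Pair 0 ` UNIV"
    using linear_span_image[of "Pair (0::'a)" "Basis :: 'b set"]
    by (simp add: linear_iff)
  then have "fst ` S = (\<lambda>x. (x, 0)) -` {z. \<exists>v\<in>span ?B. z + v \<in> S}"
    by force
  moreover have "rational_polyhedron {z. \<exists>v\<in>span ?B. z + v \<in> S}"
    using assms by (intro rational_polyhedron_eliminate_span)
      (auto simp: rational_vector_Pair intro: rational_vector_Basis)
  ultimately show ?thesis
    by (simp del: vimage_Collect_eq)
       (intro rational_polyhedron_linear_preimage;
        auto simp: linear_iff rational_vector_Pair intro: rational_vector_Basis)
qed

text \<open>
  The sum is the projection to \<open>z\<close> of the pairs \<open>(z, x)\<close> with \<open>x \<in> S\<close> and \<open>z - x \<in> T\<close>.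
\<close>

lemma rational_polyhedron_plus:
  fixes S T :: "'a::euclidean_space set"
  assumes "rational_polyhedron S" and "rational_polyhedron T"
  shows "rational_polyhedron {x + y | x y. x \<in> S \<and> y \<in> T}"
proof -
  have "{x + y | x y. x \<in> S \<and> y \<in> T} = fst ` ((\<lambda>(z, x). z - x) -` T \<inter> snd -` S)"
  proof (intro set_eqI iffI)
    fix w assume "w \<in> {x + y | x y. x \<in> S \<and> y \<in> T}"
    then obtain x y where "w = x + y" "x \<in> S" "y \<in> T"
      by blast
    then show "w \<in> fst ` ((\<lambda>(z, x). z - x) -` T \<inter> snd -` S)"
      by (intro image_eqI[of _ _ "(w, x)"]) auto
  next
    fix w assume "w \<in> fst ` ((\<lambda>(z, x). z - x) -` T \<inter> snd -` S)"
    then obtain x where "x \<in> S" "w - x \<in> T"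
      by auto
    then show "w \<in> {x + y | x y. x \<in> S \<and> y \<in> T}"
      by (intro CollectI exI[of _ x] exI[of _ "w - x"]) simp
  qed
  moreover have "rational_polyhedron ((\<lambda>(z, x). z - x :: 'a) -` T)"
    using assms(2) by (intro rational_polyhedron_linear_preimage)
      (auto simp: linear_iff algebra_simps Basis_prod_def rational_vector_Basis rational_vector_uminus)
  ultimately show ?thesis
    using assms(1)
    by (simp add: rational_polyhedron_fst_image rational_polyhedron_Int rational_polyhedron_snd_vimage)
qed

lemma rational_polyhedron_sum:
  fixes C :: "'i \<Rightarrow> 'a::euclidean_space set"
  assumes "finite I" and "\<And>i. i \<in> I \<Longrightarrow> rational_polyhedron (C i)"
  shows "rational_polyhedron {\<Sum>i\<in>I. z i | z. \<forall>i\<in>I. z i \<in> C i}"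
  using assms
proof (induction I rule: finite_induct)
  case empty
  then show ?case
    by (simp add: rational_polyhedron_singleton)
next
  case (insert j I)
  have "{\<Sum>i\<in>insert j I. z i | z. \<forall>i\<in>insert j I. z i \<in> C i}
      = {x + y | x y. x \<in> C j \<and> y \<in> {\<Sum>i\<in>I. z i | z. \<forall>i\<in>I. z i \<in> C i}}" (is "?l = ?r")
  proof (intro set_eqI iffI)
    fix w assume "w \<in> ?r"
    then obtain x z where xz: "w = x + (\<Sum>i\<in>I. z i)" "x \<in> C j" "\<forall>i\<in>I. z i \<in> C i"
      by blast
    have "(\<Sum>i\<in>I. (z(j := x)) i) = (\<Sum>i\<in>I. z i)"
      using insert.hyps by (intro sum.cong) auto
    then show "w \<in> ?l"
      using xz insert.hyps by (intro CollectI exI[of _ "z(j := x)"]) auto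
  qed (use insert.hyps in force)
  moreover have "rational_polyhedron ?r"
    using insert by (intro rational_polyhedron_plus) auto
  ultimately show ?case
    by simp
qed

section \<open>Homogenization and the convex hull of a union\<close>

text \<open>
  For a nonempty polyhedron this is the closure of the cone over \<open>K \<times> {1}\<close>. The part at height 0 is
  the recession cone, which is exactly what makes the set polyhedral.
\<close>

definition homogenization :: "'a::real_vector set \<Rightarrow> ('a \<times> real) set" where
  "homogenization K = {(t *\<^sub>R x, t) | x t. 0 < t \<and> x \<in> K} \<union> recession_cone K \<times> {0}"

text \<open>
  If \<open>r\<close> violates \<open>a \<bullet> r \<le> 0\<close>, a point of \<open>K\<close> moved far enough along \<open>r\<close> violates \<open>a \<bullet> x \<le> b\<close>. This
  requires that \<open>K\<close> has a point.
\<close>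

lemma recession_cone_halfspaces:
  fixes K :: "'a::euclidean_space set"
  assumes K: "K = {x. \<forall>p\<in>I. fst p \<bullet> x \<le> snd p}" and "K \<noteq> {}"
  shows "recession_cone K = {r. \<forall>p\<in>I. fst p \<bullet> r \<le> 0}"
proof (intro set_eqI iffI)
  fix r assume r: "r \<in> recession_cone K"
  obtain x where x: "x \<in> K"
    using assms(2) by blast
  have "fst p \<bullet> r \<le> 0" if p: "p \<in> I" for p
  proof (rule ccontr)
    assume "\<not> fst p \<bullet> r \<le> 0"
    then have pos: "fst p \<bullet> r > 0" by simp
    \<comment> \<open>The step length at which the left-hand side of the inequality \<open>p\<close> exceeds its right-hand side by 1.\<close>
    define t where "t = (snd p - fst p \<bullet> x + 1) / (fst p \<bullet> r)"
    have "fst p \<bullet> x \<le> snd p"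
      using x p K by blast
    then have "t \<ge> 0"
      using pos by (simp add: t_def)
    then have "x + t *\<^sub>R r \<in> K"
      using r x by (simp add: recession_cone_def)
    then have "fst p \<bullet> (x + t *\<^sub>R r) \<le> snd p"
      using p K by blast
    then show False
      using pos by (simp add: t_def inner_add_right)
  qed
  then show "r \<in> {r. \<forall>p\<in>I. fst p \<bullet> r \<le> 0}"
    by blast
next
  fix r assume r: "r \<in> {r. \<forall>p\<in>I. fst p \<bullet> r \<le> 0}"
  have "x + t *\<^sub>R r \<in> K" if "x \<in> K" "t \<ge> 0" for x t
  proof -
    have "fst p \<bullet> (x + t *\<^sub>R r) \<le> snd p" if "p \<in> I" for p
    proof -
      have "fst p \<bullet> x \<le> snd p" "fst p \<bullet> r \<le> 0"
        using that r \<open>x \<in> K\<close> K by auto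
      then show ?thesis
        using mult_nonneg_nonpos[OF \<open>t \<ge> 0\<close>, of "fst p \<bullet> r"] by (simp add: inner_add_right)
    qed
    then show ?thesis
      using K by blast
  qed
  then show "r \<in> recession_cone K"
    by (simp add: recession_cone_def)
qed

text \<open>
  The cone is cut out by \<open>t \<ge> 0\<close> and \<open>a \<bullet> x \<le> b * t\<close> for the inequalities \<open>a \<bullet> x \<le> b\<close> of \<open>K\<close>: for
  \<open>t > 0\<close> divide by \<open>t\<close>, and for \<open>t = 0\<close> these are the inequalities of the recession cone.
\<close>

lemma rational_polyhedron_homogenization:
  fixes K :: "'a::euclidean_space set"
  assumes "rational_polyhedron K" and "K \<noteq> {}"
  shows "rational_polyhedron (homogenization K)"
proof -
  obtain I where I: "finite I" "\<And>p. p \<in> I \<Longrightarrow> rational_vector (fst p)"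
    "\<And>p. p \<in> I \<Longrightarrow> snd p \<in> \<rat>" "K = {x. \<forall>p\<in>I. fst p \<bullet> x \<le> snd p}"
    using assms(1) by (rule rational_polyhedronE) blast
  let ?J = "insert ((0, - 1), 0) ((\<lambda>p. ((fst p, - snd p), 0)) ` I) :: (('a \<times> real) \<times> real) set"
  have "(x, t) \<in> homogenization K \<longleftrightarrow> t \<ge> 0 \<and> (\<forall>p\<in>I. fst p \<bullet> x \<le> snd p * t)" for x t
  proof (cases t "0::real" rule: linorder_cases)
    case less
    then show ?thesis
      by (auto simp: homogenization_def)
  next
    case equal
    then show ?thesis
      by (auto simp: homogenization_def recession_cone_halfspaces[OF I(4) assms(2)])
  next
    case greater
    have "(x, t) \<in> homogenization K \<longleftrightarrow> (1 / t) *\<^sub>R x \<in> K"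
      using greater by (auto simp: homogenization_def intro!: exI[of _ "(1 / t) *\<^sub>R x"])
    also have "\<dots> \<longleftrightarrow> (\<forall>p\<in>I. fst p \<bullet> x \<le> snd p * t)"
      using greater by (simp add: I(4) pos_divide_le_eq)
    finally show ?thesis
      using greater by simp
  qed
  then have "z \<in> homogenization K \<longleftrightarrow> z \<in> {z. \<forall>p\<in>?J. fst p \<bullet> z \<le> snd p}" for z
    by (cases z) simp
  then have "homogenization K = {z. \<forall>p\<in>?J. fst p \<bullet> z \<le> snd p}"
    by blast
  then show ?thesis
    by (intro rational_polyhedronI[of ?J])
       ((elim insertE imageE)?; simp add: rational_vector_Pair rational_vector_real I(1,2,3))+
qed

lemma recession_cone_sum:
  assumes "\<And>i. i \<in> J \<Longrightarrow> r i \<in> recession_cone K"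
  shows "(\<Sum>i\<in>J. r i) \<in> recession_cone K"
proof -
  have add: "r + s \<in> recession_cone K" if "r \<in> recession_cone K" "s \<in> recession_cone K" for r s
    using that by (simp add: recession_cone_def scaleR_add_right flip: add.assoc)
  have zero: "0 \<in> recession_cone K"
    by (simp add: recession_cone_def)
  show ?thesis
    using assms by (induction J rule: infinite_finite_induct) (auto intro: add zero)
qed

text \<open>
  A convex combination of points of the \<open>K i\<close> lifts to a sum of points of the cones by taking its
  weights as heights. Conversely, a sum of points of the cones with total height 1 may have
  terms at height 0, which are recession directions \<open>r\<^sub>i\<close> and not weighted points. As all \<open>K i\<close> have the
  same recession cone, the sum \<open>r\<close> of these directions can be added to the point \<open>k\<^sub>i\<close> of each term of
  positive height \<open>t\<^sub>i\<close>. Since the heights add up to 1, the points \<open>k\<^sub>i + r\<close> with weights \<open>t\<^sub>i\<close> account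
  for \<open>r\<close> exactly once.
\<close>

lemma convex_hull_Union_eq_homogenization_slice:
  fixes K :: "'i \<Rightarrow> 'a::euclidean_space set"
  assumes fin: "finite I" and conv: "\<And>i. i \<in> I \<Longrightarrow> convex (K i)"
    and ne: "\<And>i. i \<in> I \<Longrightarrow> K i \<noteq> {}"
    and rec: "\<And>i j. i \<in> I \<Longrightarrow> j \<in> I \<Longrightarrow> recession_cone (K i) = recession_cone (K j)"
  shows "convex hull (\<Union>i\<in>I. K i)
       = {x. (x, 1) \<in> {\<Sum>i\<in>I. z i | z. \<forall>i\<in>I. z i \<in> homogenization (K i)}}"
proof -
  have hull: "convex hull (\<Union>i\<in>I. K i) =
    {\<Sum>i\<in>I. c i *\<^sub>R s i | c s. (\<forall>i\<in>I. c i \<ge> 0) \<and> sum c I = 1 \<and> (\<forall>i\<in>I. s i \<in> K i)}"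
    using convex_hull_finite_union[OF fin, of K] conv ne by blast
  have 1: "(x, 1) \<in> {\<Sum>i\<in>I. z i | z. \<forall>i\<in>I. z i \<in> homogenization (K i)}"
    if x: "x \<in> convex hull (\<Union>i\<in>I. K i)" for x
  proof -
    obtain c s where cs: "x = (\<Sum>i\<in>I. c i *\<^sub>R s i)" "\<forall>i\<in>I. c i \<ge> 0" "sum c I = 1" "\<forall>i\<in>I. s i \<in> K i"
      using x unfolding hull by blast
    have "(c i *\<^sub>R s i, c i) \<in> homogenization (K i)" if "i \<in> I" for i
    proof (cases "c i = 0")
      case True
      then show ?thesis
        by (simp add: homogenization_def recession_cone_def)
    next
      case False
      then show ?thesis
        using cs that by (force simp: homogenization_def)
    qed
    moreover have "(x, 1) = (\<Sum>i\<in>I. (c i *\<^sub>R s i, c i))"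
      by (simp add: sum_prod cs)
    ultimately show ?thesis
      by blast
  qed
  have 2: "x \<in> convex hull (\<Union>i\<in>I. K i)"
    if x: "(x, 1) \<in> {\<Sum>i\<in>I. z i | z. \<forall>i\<in>I. z i \<in> homogenization (K i)}" for x
  proof -
    obtain z where z: "(x, 1) = (\<Sum>i\<in>I. z i)" "\<And>i. i \<in> I \<Longrightarrow> z i \<in> homogenization (K i)"
      using x by blast
    define t where "t i = snd (z i)" for i
    have xz: "x = (\<Sum>i\<in>I. fst (z i))" and t1: "(\<Sum>i\<in>I. t i) = 1"
      using z(1) by (simp_all add: t_def flip: fst_sum snd_sum z(1))
    have t0: "t i \<ge> 0" if "i \<in> I" for i
      using z(2)[OF that] by (auto simp: homogenization_def t_def)
    define r where "r = (\<Sum>i\<in>{i\<in>I. t i = 0}. fst (z i))"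
    have rK: "r \<in> recession_cone (K j)" if "j \<in> I" for j
      unfolding r_def
    proof (rule recession_cone_sum)
      fix i assume "i \<in> {i\<in>I. t i = 0}"
      then have i: "i \<in> I" "snd (z i) = 0"
        by (auto simp: t_def)
      then have "fst (z i) \<in> recession_cone (K i)"
        using z(2)[of i] by (auto simp: homogenization_def)
      then show "fst (z i) \<in> recession_cone (K j)"
        using rec[OF i(1) that] by simp
    qed
    \<comment> \<open>At height 0 the weight vanishes, so that any point of \<open>K i\<close> serves there.\<close>
    have "\<exists>s. s \<in> K i \<and> t i *\<^sub>R s = (if t i = 0 then 0 else fst (z i)) + t i *\<^sub>R r" if i: "i \<in> I" for i
    proof (cases "t i = 0")
      case True
      then show ?thesis
        using ne[OF i] by auto
    next
      case False
      then obtain k where k: "k \<in> K i" "fst (z i) = t i *\<^sub>R k"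
        using z(2)[OF i] by (auto simp: homogenization_def t_def)
      then have "k + 1 *\<^sub>R r \<in> K i"
        using rK[OF i] unfolding recession_cone_def by (metis (mono_tags, lifting) mem_Collect_eq zero_le_one)
      then show ?thesis
        using False k by (intro exI[of _ "k + r"]) (simp add: scaleR_add_right)
    qed
    then obtain s where s: "\<And>i. i \<in> I \<Longrightarrow> s i \<in> K i"
      "\<And>i. i \<in> I \<Longrightarrow> t i *\<^sub>R s i = (if t i = 0 then 0 else fst (z i)) + t i *\<^sub>R r"
      by metis
    have "(\<Sum>i\<in>I. t i *\<^sub>R s i) = (\<Sum>i\<in>I. if t i = 0 then 0 else fst (z i)) + (\<Sum>i\<in>I. t i) *\<^sub>R r"
      by (simp add: s(2) sum.distrib scaleR_left.sum cong: sum.cong)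
    also have "\<dots> = (\<Sum>i\<in>I. if t i = 0 then 0 else fst (z i)) + (\<Sum>i\<in>I. if t i = 0 then fst (z i) else 0)"
      using fin by (simp add: t1 r_def sum.inter_filter)
    also have "\<dots> = (\<Sum>i\<in>I. fst (z i))"
      by (subst sum.distrib[symmetric], rule sum.cong) auto
    finally have "x = (\<Sum>i\<in>I. t i *\<^sub>R s i)"
      by (simp add: xz)
    then show ?thesis
      unfolding hull using t0 t1 s(1) by blast
  qed
  show ?thesis
    using 1 2 by blast
qed

lemma rational_polyhedron_convex_hull_Union:
  fixes K :: "'i \<Rightarrow> 'a::euclidean_space set"
  assumes fin: "finite I" and K: "\<And>i. i \<in> I \<Longrightarrow> rational_polyhedron (K i)"
    and ne: "\<And>i. i \<in> I \<Longrightarrow> K i \<noteq> {}"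
    and rec: "\<And>i j. i \<in> I \<Longrightarrow> j \<in> I \<Longrightarrow> recession_cone (K i) = recession_cone (K j)"
  shows "rational_polyhedron (convex hull (\<Union>i\<in>I. K i))"
proof -
  let ?C = "{\<Sum>i\<in>I. z i | z. \<forall>i\<in>I. z i \<in> homogenization (K i)}"
  have "rational_polyhedron {x. (x, 0) + (0, 1) \<in> ?C}"
    using fin K ne
    by (intro rational_polyhedron_affine_preimage rational_polyhedron_sum rational_polyhedron_homogenization)
       (auto simp: linear_iff rational_vector_Pair rational_vector_real intro: rational_vector_Basis)
  moreover have "convex hull (\<Union>i\<in>I. K i) = {x. (x, 1) \<in> ?C}"
    using fin rational_polyhedron_convex[OF K] ne rec
    by (rule convex_hull_Union_eq_homogenization_slice)
  ultimately show ?thesis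
    by simp
qed

lemma recession_cone_Times_singleton:
  assumes "S \<noteq> {}"
  shows "recession_cone (S \<times> {c}) = recession_cone S \<times> {0}"
proof (intro set_eqI iffI)
  fix z assume z: "z \<in> recession_cone (S \<times> {c})"
  obtain x where "x \<in> S"
    using assms by blast
  then have "(x, c) + 1 *\<^sub>R z \<in> S \<times> {c}"
    using z unfolding recession_cone_def by (metis (mono_tags, lifting) mem_Collect_eq mem_Sigma_iff singletonI zero_le_one)
  then have "snd z = 0"
    by (cases z) simp
  then show "z \<in> recession_cone S \<times> {0}"
    using z by (cases z) (auto simp: recession_cone_def)
qed (auto simp: recession_cone_def)

section \<open>Slices of the embedding at binary vectors\<close>

text \<open>
  The hull of \<open>A\<close> together with the open halfspace \<open>a \<bullet> x < b\<close> is a convex set that contains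
  \<open>A \<union> B\<close>: a convex combination with a positive weight on a point of the halfspace stays in the
  halfspace. So \<open>B\<close> adds no point on the hyperplane, which supports the hull of \<open>A \<union> B\<close>.
\<close>

lemma convex_hull_Un_Int_hyperplane:
  assumes A: "\<And>x. x \<in> A \<Longrightarrow> a \<bullet> x = b" and B: "\<And>x. x \<in> B \<Longrightarrow> a \<bullet> x < b"
  shows "convex hull (A \<union> B) \<inter> {x. a \<bullet> x = b} = convex hull A"
    and "(convex hull A) face_of (convex hull (A \<union> B))"
proof -
  have hA: "convex hull A \<subseteq> {x. a \<bullet> x = b}"
    by (rule hull_minimal) (use A in \<open>auto simp: convex_hyperplane\<close>)
  let ?T = "convex hull A \<union> {x. a \<bullet> x < b}"
  have "convex ?T"
  proof (rule convexI)
    fix x y and u v :: real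
    assume xy: "x \<in> ?T" "y \<in> ?T" and uv: "0 \<le> u" "0 \<le> v" "u + v = 1"
    have le: "a \<bullet> x \<le> b" "a \<bullet> y \<le> b"
      using xy hA by auto
    show "u *\<^sub>R x + v *\<^sub>R y \<in> ?T"
    proof (cases "a \<bullet> (u *\<^sub>R x + v *\<^sub>R y) < b")
      case True
      then show ?thesis by simp
    next
      case False
      \<comment> \<open>The slack of the combination is the combination of the slacks, so that both terms vanish.\<close>
      have eq: "u * (b - a \<bullet> x) + v * (b - a \<bullet> y) = b - a \<bullet> (u *\<^sub>R x + v *\<^sub>R y)"
        using uv(3) by (simp add: inner_add_right algebra_simps flip: distrib_left)
      have nn: "u * (b - a \<bullet> x) \<ge> 0" "v * (b - a \<bullet> y) \<ge> 0"
        using le uv by simp_all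
      with eq False have "u * (b - a \<bullet> x) = 0" "v * (b - a \<bullet> y) = 0"
        by linarith+
      then have "u = 0 \<or> x \<in> convex hull A" "v = 0 \<or> y \<in> convex hull A"
        using xy by auto
      then show ?thesis
        using uv xy convexD[OF convex_convex_hull, of x A y u v] by auto
    qed
  qed
  then have T: "convex hull (A \<union> B) \<subseteq> ?T"
    by (intro hull_minimal) (use B in \<open>auto intro: hull_inc\<close>)
  moreover have "convex hull A \<subseteq> convex hull (A \<union> B)"
    by (intro hull_mono) simp
  ultimately show eq: "convex hull (A \<union> B) \<inter> {x. a \<bullet> x = b} = convex hull A"
    using hA by force
  have "a \<bullet> x \<le> b" if "x \<in> convex hull (A \<union> B)" for x
    using that T hA by force
  then show "(convex hull A) face_of (convex hull (A \<union> B))"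
    using face_of_Int_supporting_hyperplane_le[OF convex_convex_hull, of "A \<union> B" a b] eq by simp
qed

text \<open>
  The functional with coefficient \<open>1\<close> where \<open>v\<close> is \<open>1\<close> and \<open>- 1\<close> where \<open>v\<close> is \<open>0\<close> drops by one for each
  coordinate in which a binary vector differs from \<open>v\<close>.
\<close>

lemma binary_vector_exposed:
  fixes v w :: "real ^ 'k"
  assumes v: "\<And>j. v $ j \<in> {0, 1}" and w: "\<And>j. w $ j \<in> {0, 1}" and "w \<noteq> v"
  shows "(\<chi> j. 2 * v $ j - 1) \<bullet> w < (\<chi> j. 2 * v $ j - 1) \<bullet> v"
proof -
  have "(\<Sum>j\<in>UNIV. (2 * v $ j - 1) * w $ j) < (\<Sum>j\<in>UNIV. (2 * v $ j - 1) * v $ j)"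
  proof (rule sum_strict_mono_ex1)
    show "\<forall>j\<in>UNIV. (2 * v $ j - 1) * w $ j \<le> (2 * v $ j - 1) * v $ j"
    proof
      fix j show "(2 * v $ j - 1) * w $ j \<le> (2 * v $ j - 1) * v $ j"
        using v[of j] w[of j] by auto
    qed
    obtain j where "w $ j \<noteq> v $ j"
      using \<open>w \<noteq> v\<close> by (auto simp: vec_eq_iff)
    then show "\<exists>j\<in>UNIV. (2 * v $ j - 1) * w $ j < (2 * v $ j - 1) * v $ j"
      using v[of j] w[of j] by (intro bexI[of _ j]) auto
  qed simp
  then show ?thesis
    by (simp add: inner_vec_def)
qed

text \<open>
  The functional that exposes \<open>v\<close> in the cube, extended by zero to the first factor, is maximal on
  the sets \<open>P i \<times> {h i}\<close> with \<open>h i = v\<close> and strictly smaller on all others.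
\<close>

lemma embedding_hull_binary_slice:
  fixes P :: "nat \<Rightarrow> (real ^ 'd) set" and h :: "nat \<Rightarrow> real ^ 'k"
  assumes h: "\<And>i j. i \<in> {1..n} \<Longrightarrow> h i $ j \<in> {0, 1}" and v: "\<And>j. v $ j \<in> {0, 1}"
  defines "A \<equiv> (convex hull (\<Union>i\<in>{i\<in>{1..n}. h i = v}. P i)) \<times> {v}"
  shows "embedding_hull n P h \<inter> (UNIV \<times> {v}) = A" and "A face_of embedding_hull n P h"
proof -
  define c where "c = (\<chi> j. 2 * v $ j - 1)"
  let ?A = "\<Union>i\<in>{i\<in>{1..n}. h i = v}. P i \<times> {h i}"
  let ?B = "\<Union>i\<in>{i\<in>{1..n}. h i \<noteq> v}. P i \<times> {h i}"
  have E: "embedding_hull n P h = convex hull (?A \<union> ?B)"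
    unfolding embedding_hull_def by (rule arg_cong[where f = "\<lambda>S. convex hull S"]) auto
  have "?A = (\<Union>i\<in>{i\<in>{1..n}. h i = v}. P i) \<times> {v}"
    by auto
  then have A: "convex hull ?A = A"
    by (simp add: A_def convex_hull_Times)
  have 1: "(0, c) \<bullet> z = c \<bullet> v" if "z \<in> ?A" for z
    using that by auto
  have 2: "(0, c) \<bullet> z < c \<bullet> v" if "z \<in> ?B" for z
    using that binary_vector_exposed[OF v h] by (auto simp: c_def)
  note slice = convex_hull_Un_Int_hyperplane[of ?A "(0, c)" "c \<bullet> v" ?B, OF 1 2]
  show "A face_of embedding_hull n P h"
    using slice(2) by (simp only: E A)
  have "embedding_hull n P h \<inter> (UNIV \<times> {v}) \<subseteq> embedding_hull n P h \<inter> {z. (0, c) \<bullet> z = c \<bullet> v}"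
    by auto
  also have "\<dots> = A"
    using slice(1) by (simp only: E A)
  finally show "embedding_hull n P h \<inter> (UNIV \<times> {v}) = A"
    using \<open>A face_of _\<close>[THEN face_of_imp_subset] by (auto simp: A_def)
qed

lemma embedding_hull_snd_in_unit_cube:
  fixes P :: "nat \<Rightarrow> (real ^ 'd) set" and h :: "nat \<Rightarrow> real ^ 'k"
  assumes "\<And>i j. i \<in> {1..n} \<Longrightarrow> h i $ j \<in> {0, 1}" and "(x, y) \<in> embedding_hull n P h"
  shows "0 \<le> y $ j" and "y $ j \<le> 1"
proof -
  have "embedding_hull n P h \<subseteq> UNIV \<times> cbox 0 1"
    unfolding embedding_hull_def
  proof (rule hull_minimal)
    show "(\<Union>i\<in>{1..n}. P i \<times> {h i}) \<subseteq> UNIV \<times> cbox 0 1"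
    proof -
      have "h i \<in> cbox 0 1" if "i \<in> {1..n}" for i
        unfolding mem_box_cart
      proof
        fix j show "0 $ j \<le> h i $ j \<and> h i $ j \<le> 1 $ j"
          using assms(1)[OF that, of j] by auto
      qed
      then show ?thesis
        by auto
    qed
  qed (simp add: convex_Times)
  then have "y \<in> cbox 0 1"
    using assms(2) by blast
  then show "0 \<le> y $ j" and "y $ j \<le> 1"
    by (simp_all add: mem_box_cart)
qed

theorem corollary1:
  fixes n :: nat
    and P :: "nat \<Rightarrow> (real ^ 'd) set"
    and h :: "nat \<Rightarrow> real ^ 'k"
  assumes "n \<ge> 1"
    and "\<And>i. i \<in> {1..n} \<Longrightarrow> rational_polyhedron (P i)"
    and "\<And>i. i \<in> {1..n} \<Longrightarrow> ext (P i) \<noteq> {}"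
    and "\<And>i j. i \<in> {1..n} \<Longrightarrow> j \<in> {1..n} \<Longrightarrow> recession_cone (P i) = recession_cone (P j)"
    and "int CARD('k) \<ge> \<lceil>log 2 (real n)\<rceil>"
    and "\<And>i j. i \<in> {1..n} \<Longrightarrow> h i $ j \<in> {0, 1}"
    and "inj_on h {1..n}"
  shows "ideal_formulation (embedding_hull n P h) (\<Union>i\<in>{1..n}. P i)
       \<and> rational_polyhedron (embedding_hull n P h)"
proof -
  let ?Q = "embedding_hull n P h"
  have ne: "P i \<noteq> {}" if "i \<in> {1..n}" for i
    using assms(3)[OF that] by (auto simp: ext_def extreme_point_of_def)
  have h_int: "h i \<in> int_vectors" if "i \<in> {1..n}" for i
    unfolding int_vectors_def
  proof (intro CollectI allI)
    fix j show "h i $ j \<in> \<int>"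
      using assms(6)[OF that, of j] by auto
  qed
  have h_rat: "rational_vector (h i)" if "i \<in> {1..n}" for i
    unfolding rational_vector_def
  proof
    fix e :: "real ^ 'k" assume "e \<in> Basis"
    then obtain j where "h i \<bullet> e = h i $ j"
      by (auto simp: Basis_vec_def inner_axis)
    then show "h i \<bullet> e \<in> \<rat>"
      using assms(6)[OF that, of j] by auto
  qed
  have Q: "rational_polyhedron ?Q"
    unfolding embedding_hull_def
  proof (rule rational_polyhedron_convex_hull_Union)
    show "rational_polyhedron (P i \<times> {h i})" if "i \<in> {1..n}" for i
      using assms(2)[OF that] h_rat[OF that]
      by (simp add: rational_polyhedron_Times rational_polyhedron_singleton)
    show "recession_cone (P i \<times> {h i}) = recession_cone (P j \<times> {h j})"
      if "i \<in> {1..n}" "j \<in> {1..n}" for i j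
      using assms(4)[OF that] that by (simp add: recession_cone_Times_singleton ne)
  qed (use ne in auto)
  have slice: "?Q \<inter> (UNIV \<times> {h i}) = P i \<times> {h i}" "(P i \<times> {h i}) face_of ?Q" if i: "i \<in> {1..n}" for i
  proof -
    have "{j\<in>{1..n}. h j = h i} = {i}"
      using i assms(7) by (auto dest: inj_onD)
    moreover have "convex hull (P i) = P i"
      using assms(2)[OF i] by (simp add: rational_polyhedron_convex convex_hull_eq)
    ultimately show "?Q \<inter> (UNIV \<times> {h i}) = P i \<times> {h i}" "(P i \<times> {h i}) face_of ?Q"
      using embedding_hull_binary_slice[of n h "h i" P] assms(6) i by simp_all
  qed
  have "ext ?Q \<noteq> {}"
  proof -
    have 1: "1 \<in> {1..n}"
      using assms(1) by simp
    then obtain x where "x extreme_point_of P 1"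
      using assms(3) by (auto simp: ext_def)
    then have "(x, h 1) extreme_point_of (P 1 \<times> {h 1})"
      by (auto simp: extreme_point_of_def open_segment_def closed_segment_def)
    then have "(x, h 1) extreme_point_of ?Q"
      using extreme_point_of_face[OF slice(2)[OF 1]] by blast
    then show ?thesis
      by (auto simp: ext_def)
  qed
  moreover have "(\<Union>i\<in>{1..n}. P i) = fst ` (?Q \<inter> (UNIV \<times> int_vectors))"
  proof (intro set_eqI iffI)
    fix x assume "x \<in> (\<Union>i\<in>{1..n}. P i)"
    then obtain i where i: "i \<in> {1..n}" "x \<in> P i"
      by blast
    then have "(x, h i) \<in> ?Q"
      unfolding embedding_hull_def by (intro hull_inc) blast
    then show "x \<in> fst ` (?Q \<inter> (UNIV \<times> int_vectors))"
      using h_int[OF i(1)] by force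
  next
    fix x assume "x \<in> fst ` (?Q \<inter> (UNIV \<times> int_vectors))"
    then obtain y where xy: "(x, y) \<in> ?Q" "y \<in> int_vectors"
      by auto
    have y: "y $ j \<in> {0, 1}" for j
    proof -
      obtain m :: int where "y $ j = m"
        using xy(2) by (auto simp: int_vectors_def elim: Ints_cases)
      moreover have "0 \<le> y $ j" "y $ j \<le> 1"
        using embedding_hull_snd_in_unit_cube[OF assms(6) xy(1)] by auto
      ultimately have "m = 0 \<or> m = 1"
        by auto
      then show ?thesis
        using \<open>y $ j = m\<close> by auto
    qed
    have "{i\<in>{1..n}. h i = y} \<noteq> {}"
    proof
      assume none: "{i\<in>{1..n}. h i = y} = {}"
      have "?Q \<inter> (UNIV \<times> {y}) = {}"
        by (subst embedding_hull_binary_slice(1)) (use assms(6) y none in \<open>auto simp del: atLeastAtMost_iff\<close>)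
      then show False
        using xy(1) by blast
    qed
    then obtain i where i: "i \<in> {1..n}" "h i = y"
      by blast
    have "(x, y) \<in> P i \<times> {h i}"
      unfolding slice(1)[OF i(1), symmetric] using xy(1) i(2) by simp
    then show "x \<in> (\<Union>i\<in>{1..n}. P i)"
      using i(1) by blast
  qed
  moreover have "y \<in> int_vectors" if "(x, y) \<in> ext ?Q" for x y
  proof -
    have "(x, y) \<in> (\<Union>i\<in>{1..n}. P i \<times> {h i})"
      using that unfolding ext_def embedding_hull_def by (auto dest: extreme_point_of_convex_hull)
    then show ?thesis
      using h_int by blast
  qed
  ultimately show ?thesis
    using Q by (auto simp: ideal_formulation_def mip_formulation_def)
qed

end
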